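(* Let $b:\mathbb N\to\mathbb R$ be a real sequence such that the sequence $\bigl(\frac{b(n)}{n}\bigr)_{n\in\mathbb Z_+}$ is bounded from above and $b$ is not bounded from above, and let $c$ be the least concave majorant of $b$. Then $c$ is strictly increasing, $\lim_{n\to+\infty}c(n)=+\infty$ and $\limsup_{n\to+\infty}\frac{b(n)}{c(n)}=1$.
   Context: $\mathbb N$ is the set of nonnegative integers and $\mathbb Z_+$ the set of strictly positive integers. A real sequence $a:\mathbb N\to\mathbb R$ is concave if the sequence $(a(n+1)-a(n))_{n\in\mathbb N}$ is nonincreasing. A majorant of $b$ is a real sequence $c:\mathbb N\to\mathbb R$ with $c(n)\ge b(n)$ for every $n\in\mathbb N$. A real sequence $b$ has a concave majorant if and only if $(b(n)/n)_{n\in\mathbb Z_+}$ is bounded from above, and in that case it has a least concave majorant $c$, given by $c(n)=\inf\{a(n): a\in\mathbb R^{\mathbb N},\ a\text{ a concave majorant of }b\}$ for every $n\in\mathbb N$. *)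

theory Defs
  imports "HOL-Analysis.Analysis"
begin

text \<open>
  The library's \<^const>\<open>concave_on\<close> concerns functions on subsets of real vector spaces, so it
  does not apply to sequences.
\<close>

definition concave_seq :: "(nat \<Rightarrow> real) \<Rightarrow> bool" where
  "concave_seq a \<longleftrightarrow> decseq (\<lambda>n. a (Suc n) - a n)"

definition concave_majorant :: "(nat \<Rightarrow> real) \<Rightarrow> (nat \<Rightarrow> real) \<Rightarrow> bool" where
  "concave_majorant b a \<longleftrightarrow> concave_seq a \<and> (\<forall>n. b n \<le> a n)"

text \<open>
  The infimum is meaningful only if \<open>b\<close> has a concave majorant; the lemma
  \<open>least_concave_majorant\<close> below shows that it then is the least one for the pointwise order.
\<close>

definition least_concave_majorant :: "(nat \<Rightarrow> real) \<Rightarrow> nat \<Rightarrow> real" where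
  "least_concave_majorant b n = Inf {a n | a. concave_majorant b a}"

lemma concave_majorant_exists:
  assumes "bdd_above ((\<lambda>n. b n / real n) ` {0<..})"
  shows "\<exists>a. concave_majorant b a"
proof -
  obtain M where M: "\<And>n. n > 0 \<Longrightarrow> b n / real n \<le> M"
    using assms by (auto simp: bdd_above_def)
  have "b n \<le> \<bar>b 0\<bar> + M * real n" for n
  proof (cases "n = 0")
    case False
    then have "b n \<le> M * real n"
      using M[of n] by (simp add: field_simps)
    then show ?thesis by linarith
  qed simp
  moreover have "concave_seq (\<lambda>n. \<bar>b 0\<bar> + M * real n)"
    by (simp add: concave_seq_def decseq_def algebra_simps)
  ultimately show ?thesis
    unfolding concave_majorant_def by blast
qed

lemma least_concave_majorant:
  assumes "bdd_above ((\<lambda>n. b n / real n) ` {0<..})"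
  shows "concave_majorant b (least_concave_majorant b)"
    and "concave_majorant b a \<Longrightarrow> least_concave_majorant b \<le> a"
proof -
  obtain a0 where a0: "concave_majorant b a0"
    using concave_majorant_exists[OF assms] by blast
  have le: "least_concave_majorant b n \<le> a n" if "concave_majorant b a" for a n
    unfolding least_concave_majorant_def
    by (rule cInf_lower) (use that in \<open>auto simp: bdd_below_def concave_majorant_def\<close>)
  have ge: "x \<le> least_concave_majorant b n"
    if "\<And>a. concave_majorant b a \<Longrightarrow> x \<le> a n" for x n
    unfolding least_concave_majorant_def
    by (rule cInf_greatest) (use that a0 in auto)
  let ?c = "least_concave_majorant b"
  have "?c (Suc (Suc n)) - ?c (Suc n) \<le> ?c (Suc n) - ?c n" for n
  proof -
    have "(?c (Suc (Suc n)) + ?c n) / 2 \<le> ?c (Suc n)"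
    proof (rule ge)
      fix a assume a: "concave_majorant b a"
      then have "a (Suc (Suc n)) - a (Suc n) \<le> a (Suc n) - a n"
        by (auto simp: concave_majorant_def concave_seq_def decseq_Suc_iff)
      then show "(?c (Suc (Suc n)) + ?c n) / 2 \<le> a (Suc n)"
        using le[OF a, of n] le[OF a, of "Suc (Suc n)"] by simp
    qed
    then show ?thesis by simp
  qed
  then show "concave_majorant b ?c"
    using ge by (auto simp: concave_majorant_def concave_seq_def decseq_Suc_iff)
  show "concave_majorant b a \<Longrightarrow> ?c \<le> a"
    by (simp add: le le_funI)
qed

end

theory Submission
  imports Defs
begin

text \<open>
  If an increment of \<open>c\<close> were nonpositive, then \<open>c\<close>, hence \<open>b\<close>, would be bounded above.
  If \<open>b(n) \<le> l c(n)\<close> held for all large \<open>n\<close> with some \<open>0 \<le> l < 1\<close>, then \<open>l c + K\<close> would be a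
  concave majorant of \<open>b\<close> for a suitable constant \<open>K\<close>; minimality gives \<open>c \<le> l c + K\<close>, so \<open>c\<close>
  would again be bounded.
\<close>

text \<open>Increments are nonincreasing, so from index \<open>k\<close> on they all stay
  nonpositive; the largest of \<open>c 0\<close>, ..., \<open>c k\<close> then bounds every
  term.\<close>

lemma concave_seq_bounded_above:
  assumes "concave_seq c" and "c (Suc k) \<le> c k"
  shows "bdd_above (range c)"
proof -
  have le_step: "c (Suc n) \<le> c n" if "n \<ge> k" for n
    using assms that decseqD[of "\<lambda>n. c (Suc n) - c n" k n]
    by (simp add: concave_seq_def)
  have tail: "c n \<le> c k" if "n \<ge> k" for n
    using that
  proof (induction n rule: dec_induct)
    case (step n)
    then show ?case using le_step[of n] by simp
  qed simp
  have "c n \<le> Max (c ` {..k})" for n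
  proof (cases "n \<le> k")
    case False
    then have "c n \<le> c k" using tail by simp
    also have "\<dots> \<le> Max (c ` {..k})" by simp
    finally show ?thesis .
  qed simp
  then show ?thesis by (auto simp: bdd_above_def)
qed

lemma concave_seq_affine:
  assumes "concave_seq c" and "0 \<le> l"
  shows "concave_seq (\<lambda>n. l * c n + K)"
proof -
  have "decseq (\<lambda>n. l * (c (Suc n) - c n))"
    using assms by (auto simp: concave_seq_def decseq_def intro: mult_left_mono)
  then show ?thesis
    by (simp add: concave_seq_def right_diff_distrib)
qed

text \<open>Only the finitely many indices below \<open>N\<close> can violate
  \<open>b n \<le> l * c n\<close>, and a constant shift, which leaves increments unchanged, absorbs
  them.\<close>

lemma concave_majorant_affine:
  assumes c: "concave_seq c" and l: "0 \<le> l" and le: "\<And>n. n \<ge> N \<Longrightarrow> b n \<le> l * c n"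
  shows "\<exists>K. concave_majorant b (\<lambda>n. l * c n + K)"
proof -
  \<comment> \<open>The sum dominates each single excess below \<open>N\<close>, and its
    nonnegativity keeps the bound valid from \<open>N\<close> on.\<close>
  define K where "K = (\<Sum>n<N. \<bar>b n - l * c n\<bar>)"
  have "b n \<le> l * c n + K" for n
  proof (cases "n < N")
    case True
    then have "\<bar>b n - l * c n\<bar> \<le> K"
      unfolding K_def by (intro member_le_sum) auto
    then show ?thesis by linarith
  next
    case False
    moreover have "0 \<le> K" by (simp add: K_def sum_nonneg)
    ultimately show ?thesis using le[of n] by simp
  qed
  then show ?thesis
    using concave_seq_affine[OF c l] unfolding concave_majorant_def by blast
qed

theorem theorem3p9:
  fixes b c :: "nat \<Rightarrow> real"
  assumes "bdd_above ((\<lambda>n. b n / real n) ` {0<..})"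
    and "\<not> bdd_above (range b)"
    and "c = least_concave_majorant b"
  shows "strict_mono c
    \<and> filterlim c at_top sequentially
    \<and> limsup (\<lambda>n. ereal (b n / c n)) = 1"
proof -
  have c: "concave_seq c" and bc: "\<And>n. b n \<le> c n"
    using least_concave_majorant(1)[OF assms(1)] assms(3)
    by (auto simp: concave_majorant_def)
  have least: "c n \<le> a n" if "concave_majorant b a" for a n
    using least_concave_majorant(2)[OF assms(1) that] assms(3) by (auto simp: le_fun_def)
  have unbounded: "\<not> bdd_above (range c)"
  proof
    assume "bdd_above (range c)"
    then obtain M where "\<And>n. c n \<le> M" by (auto simp: bdd_above_def)
    with bc have "b n \<le> M" for n by (rule order_trans)
    then show False using assms(2) by (auto simp: bdd_above_def)
  qed
  have mono: "strict_mono c"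
    using concave_seq_bounded_above[OF c] unbounded
    by (auto simp: strict_mono_Suc_iff not_le[symmetric])
  have lim: "filterlim c at_top sequentially"
    unfolding filterlim_at_top
  proof
    fix Z
    have "\<exists>n. \<not> c n \<le> Z"
      using unbounded unfolding bdd_above_def by blast
    then obtain n where "Z < c n" by (auto simp: not_le)
    then have "Z \<le> c m" if "m \<ge> n" for m
      using strict_mono_less_eq[OF mono, of n m] that by simp
    then show "\<forall>\<^sub>F m in sequentially. Z \<le> c m"
      by (auto simp: eventually_sequentially)
  qed
  then have pos: "\<forall>\<^sub>F n in sequentially. 0 < c n"
    by (simp add: filterlim_at_top_dense)
  \<comment> \<open>Early terms of \<open>c\<close> may be negative or zero, so
    \<open>b n \<le> c n\<close> can be divided by \<open>c n\<close> only eventually, which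
    suffices for the limsup.\<close>
  have upper: "limsup (\<lambda>n. ereal (b n / c n)) \<le> 1"
    by (rule Limsup_bounded, use pos in eventually_elim) (use bc in \<open>simp add: one_ereal_def\<close>)
  have lower: "1 \<le> limsup (\<lambda>n. ereal (b n / c n))"
  proof (rule ccontr)
    assume "\<not> ?thesis"
    then have "limsup (\<lambda>n. ereal (b n / c n)) < 1" by simp
    from ereal_dense2[OF this]
    obtain r where r: "limsup (\<lambda>n. ereal (b n / c n)) < ereal r" "ereal r < 1"
      by blast
    \<comment> \<open>The number \<open>r\<close> may be negative, while scaling by \<open>l\<close>
      preserves concavity only for \<open>0 \<le> l\<close>; the maximum is still below 1.\<close>
    define l where "l = max r 0"
    have l: "0 \<le> l" "l < 1" using r(2) by (auto simp: l_def one_ereal_def)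
    have "\<forall>\<^sub>F n in sequentially. b n \<le> l * c n"
      using Limsup_lessD[OF r(1)] pos
    proof eventually_elim
      case (elim n)
      then have "b n / c n \<le> l" by (simp add: l_def)
      with elim show ?case by (simp add: divide_le_eq)
    qed
    then obtain N where "\<And>n. n \<ge> N \<Longrightarrow> b n \<le> l * c n"
      by (auto simp: eventually_sequentially)
    then obtain K where "concave_majorant b (\<lambda>n. l * c n + K)"
      using concave_majorant_affine[OF c l(1)] by blast
    then have "c n \<le> l * c n + K" for n
      by (rule least)
    \<comment> \<open>Since \<open>1 - l\<close> is positive, solving for \<open>c n\<close> gives a
      bound independent of \<open>n\<close>.\<close>
    then have "c n \<le> K / (1 - l)" for n
      using l(2) by (simp add: le_divide_eq algebra_simps)
    then have "bdd_above (range c)" by (rule bdd_aboveI2)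
    with unbounded show False ..
  qed
  show ?thesis using mono lim upper lower by (simp add: antisym)
qed

end
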